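(* Let $G_1=(V_1,E_1)$ and $G_2=(V_2,E_2)$ be two connected graphs with disjoint vertex sets, and let $x_1y_1\in E_1$ and $x_2y_2\in E_2$. Let $G_3=G_1(x_1y_1)+_H G_2(x_2y_2)$ be their Hajós sum. Then $\gamma_{coe}(G_3)\le \gamma_{coe}(G_1)+\gamma_{coe}(G_2)+1$.
   Context: All graphs are finite and simple. A dominating set of a graph $X=(V,E)$ is a set $D\subseteq V$ such that every vertex in $V\setminus D$ is adjacent to at least one vertex of $D$. A dominating set $D$ is a co-even dominating set if every vertex $v\in V\setminus D$ has even degree in $X$. The co-even domination number $\gamma_{coe}(X)$ is the minimum cardinality of a co-even dominating set of $X$. The Hajós sum $G_1(x_1y_1)+_H G_2(x_2y_2)$ is obtained from the disjoint union $(V_1\cup V_2,E_1\cup E_2)$ by deleting the edges $x_1y_1$ and $x_2y_2$, identifying the vertices $x_1$ and $x_2$ into a single vertex, and adding the edge $y_1y_2$. *)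

theory Defs
  imports "Graph_Theory.Graph_Theory"
begin

text \<open>
  A finite simple graph is a \<^locale>\<open>pair_graph\<close>: a finite, loop-free, symmetric digraph whose
  arcs are pairs of vertices, so that an undirected edge \<open>uv\<close> is the pair of arcs
  \<open>(u, v)\<close> and \<open>(v, u)\<close>.
\<close>

text \<open>By symmetry, each edge at \<open>v\<close> contributes exactly one arc leaving \<open>v\<close>.\<close>

definition degree :: "'a pair_pre_digraph \<Rightarrow> 'a \<Rightarrow> nat" where
  "degree G v = out_degree (with_proj G) v"

definition dominating_set :: "'a pair_pre_digraph \<Rightarrow> 'a set \<Rightarrow> bool" where
  "dominating_set G D \<longleftrightarrow>
     D \<subseteq> pverts G \<and> (\<forall>v \<in> pverts G - D. \<exists>u \<in> D. (v, u) \<in> parcs G)"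

definition co_even_dominating_set :: "'a pair_pre_digraph \<Rightarrow> 'a set \<Rightarrow> bool" where
  "co_even_dominating_set G D \<longleftrightarrow>
     dominating_set G D \<and> (\<forall>v \<in> pverts G - D. even (degree G v))"

definition co_even_domination_number :: "'a pair_pre_digraph \<Rightarrow> nat" where
  "co_even_domination_number G = Min {card D | D. co_even_dominating_set G D}"

text \<open>
  Identification of \<open>x\<close> and \<open>x'\<close> is the quotient map that sends both to the representative \<open>x\<close>.
\<close>

definition identify :: "'a \<Rightarrow> 'a \<Rightarrow> 'a \<Rightarrow> 'a" where
  "identify x x' v = (if v = x' then x else v)"

text \<open>
  The following is the intended notion only if the two vertex sets are disjoint, so that the
  plain union of the two graphs is their disjoint union.
\<close>

definition hajos_sum ::
  "'a pair_pre_digraph \<Rightarrow> 'a \<Rightarrow> 'a \<Rightarrow> 'a pair_pre_digraph \<Rightarrow> 'a \<Rightarrow> 'a \<Rightarrow> 'a pair_pre_digraph" where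
  "hajos_sum G\<^sub>1 x\<^sub>1 y\<^sub>1 G\<^sub>2 x\<^sub>2 y\<^sub>2 =
     \<lparr> pverts = identify x\<^sub>1 x\<^sub>2 ` (pverts G\<^sub>1 \<union> pverts G\<^sub>2),
       parcs = map_prod (identify x\<^sub>1 x\<^sub>2) (identify x\<^sub>1 x\<^sub>2) `
                 ((parcs G\<^sub>1 \<union> parcs G\<^sub>2) - {(x\<^sub>1, y\<^sub>1), (y\<^sub>1, x\<^sub>1), (x\<^sub>2, y\<^sub>2), (y\<^sub>2, x\<^sub>2)})
               \<union> {(y\<^sub>1, y\<^sub>2), (y\<^sub>2, y\<^sub>1)} \<rparr>"

text \<open>The minimum above ranges over a finite nonempty set.\<close>

lemma finite_co_even_dominating_cards:
  assumes "pair_graph G"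
  shows "finite {card D | D. co_even_dominating_set G D}"
proof -
  interpret pair_graph G by fact
  have "{card D | D. co_even_dominating_set G D} \<subseteq> card ` Pow (pverts G)"
    by (auto simp: co_even_dominating_set_def dominating_set_def)
  then show ?thesis
    using pair_finite_verts by (meson finite_Pow_iff finite_imageI finite_subset)
qed

lemma co_even_dominating_set_pverts: "co_even_dominating_set G (pverts G)"
  by (simp add: co_even_dominating_set_def dominating_set_def)

lemma pair_graph_hajos_sum:
  assumes "pair_graph G\<^sub>1" "pair_graph G\<^sub>2" "pverts G\<^sub>1 \<inter> pverts G\<^sub>2 = {}"
    and "(x\<^sub>1, y\<^sub>1) \<in> parcs G\<^sub>1" "(x\<^sub>2, y\<^sub>2) \<in> parcs G\<^sub>2"
  shows "pair_graph (hajos_sum G\<^sub>1 x\<^sub>1 y\<^sub>1 G\<^sub>2 x\<^sub>2 y\<^sub>2)"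
proof -
  interpret G1: pair_graph G\<^sub>1 by fact
  interpret G2: pair_graph G\<^sub>2 by fact
  let ?H = "hajos_sum G\<^sub>1 x\<^sub>1 y\<^sub>1 G\<^sub>2 x\<^sub>2 y\<^sub>2"
  have w1: "a \<in> pverts G\<^sub>1 \<and> b \<in> pverts G\<^sub>1 \<and> a \<noteq> b \<and> (b, a) \<in> parcs G\<^sub>1"
    if "(a, b) \<in> parcs G\<^sub>1" for a b
    using that G1.wellformed[OF that] G1.no_loops[OF that] G1.arcs_symmetric[OF that] by auto
  have w2: "a \<in> pverts G\<^sub>2 \<and> b \<in> pverts G\<^sub>2 \<and> a \<noteq> b \<and> (b, a) \<in> parcs G\<^sub>2"
    if "(a, b) \<in> parcs G\<^sub>2" for a b
    using that G2.wellformed[OF that] G2.no_loops[OF that] G2.arcs_symmetric[OF that] by auto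
  have V: "pverts ?H = identify x\<^sub>1 x\<^sub>2 ` (pverts G\<^sub>1 \<union> pverts G\<^sub>2)"
    by (simp add: hajos_sum_def)
  have A: "(a, b) \<in> parcs ?H \<longleftrightarrow>
      (\<exists>c d. ((c, d) \<in> parcs G\<^sub>1 \<or> (c, d) \<in> parcs G\<^sub>2) \<and>
        (c, d) \<notin> {(x\<^sub>1, y\<^sub>1), (y\<^sub>1, x\<^sub>1), (x\<^sub>2, y\<^sub>2), (y\<^sub>2, x\<^sub>2)} \<and>
        a = identify x\<^sub>1 x\<^sub>2 c \<and> b = identify x\<^sub>1 x\<^sub>2 d)
      \<or> (a, b) = (y\<^sub>1, y\<^sub>2) \<or> (a, b) = (y\<^sub>2, y\<^sub>1)" for a b
    unfolding hajos_sum_def by (auto simp: image_iff map_prod_def split: prod.splits)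
  have e: "x\<^sub>1 \<in> pverts G\<^sub>1" "y\<^sub>1 \<in> pverts G\<^sub>1" "x\<^sub>2 \<in> pverts G\<^sub>2" "y\<^sub>2 \<in> pverts G\<^sub>2"
    "x\<^sub>1 \<noteq> y\<^sub>1" "x\<^sub>2 \<noteq> y\<^sub>2"
    using w1[OF assms(4)] w2[OF assms(5)] by auto
  have y: "identify x\<^sub>1 x\<^sub>2 y\<^sub>1 = y\<^sub>1" "identify x\<^sub>1 x\<^sub>2 y\<^sub>2 = y\<^sub>2" "y\<^sub>1 \<noteq> y\<^sub>2"
    using e assms(3) by (auto simp: identify_def)
  have yV: "y\<^sub>1 \<in> pverts ?H" "y\<^sub>2 \<in> pverts ?H"
    unfolding V using y e by (metis Un_iff image_eqI)+
  have arc: "a \<in> pverts ?H \<and> b \<in> pverts ?H \<and> a \<noteq> b \<and> (b, a) \<in> parcs ?H"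
    if ab: "(a, b) \<in> parcs ?H" for a b
  proof (cases "(a, b) = (y\<^sub>1, y\<^sub>2) \<or> (a, b) = (y\<^sub>2, y\<^sub>1)")
    case True
    then show ?thesis using yV y(3) A[of b a] by auto
  next
    case False
    then obtain c d where cd: "(c, d) \<in> parcs G\<^sub>1 \<or> (c, d) \<in> parcs G\<^sub>2"
      "(c, d) \<notin> {(x\<^sub>1, y\<^sub>1), (y\<^sub>1, x\<^sub>1), (x\<^sub>2, y\<^sub>2), (y\<^sub>2, x\<^sub>2)}"
      "a = identify x\<^sub>1 x\<^sub>2 c" "b = identify x\<^sub>1 x\<^sub>2 d"
      using ab unfolding A by blast
    have V': "c \<in> pverts G\<^sub>1 \<and> d \<in> pverts G\<^sub>1 \<or> c \<in> pverts G\<^sub>2 \<and> d \<in> pverts G\<^sub>2"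
      and ne: "c \<noteq> d" and rev: "(d, c) \<in> parcs G\<^sub>1 \<or> (d, c) \<in> parcs G\<^sub>2"
      using cd(1) w1[of c d] w2[of c d] by blast+
    have "(b, a) \<in> parcs ?H"
      unfolding A using cd(2-4) rev by blast
    moreover have "a \<noteq> b"
      using V' ne e assms(3) unfolding cd(3,4) identify_def by auto
    ultimately show ?thesis using V' unfolding V cd(3,4) by blast
  qed
  show ?thesis
  proof
    show "finite (pverts ?H)" "finite (parcs ?H)"
      by (simp_all add: hajos_sum_def)
    show "symmetric (with_proj ?H)"
      unfolding symmetric_def by (rule symI) (use arc in simp)
  qed (use arc in \<open>metis prod.collapse\<close>)+
qed

end

theory Submission
  imports Defs
begin

text \<open>
  Let \<open>D\<^sub>1\<close>, \<open>D\<^sub>2\<close> be minimum co-even dominating sets. Only the identified vertex \<open>x\<close> changes its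
  degree in the Hajos sum, so \<open>x\<close> is put into the new set. The only vertices that may then lose their
  dominator are \<open>y\<^sub>1\<close> and \<open>y\<^sub>2\<close>, and \<open>y\<^sub>i\<close> loses it only if \<open>x\<^sub>i \<in> D\<^sub>i\<close>. Exchanging \<open>x\<^sub>i\<close> for \<open>y\<^sub>i\<close> in
  \<open>D\<^sub>i\<close> in that case costs nothing, so \<open>x\<close> is the only extra vertex.
\<close>

text \<open>Dropping \<open>x\<close> is safe because the final set contains the image of
  \<open>x\<close> in any case; \<open>y\<close> enters so that it no longer relies on
  \<open>x\<close> as its dominator. The set shrinks if both \<open>x\<close> and \<open>y\<close>
  lie in \<open>D\<close>.\<close>

definition exchange :: "'a \<Rightarrow> 'a \<Rightarrow> 'a set \<Rightarrow> 'a set" where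
  "exchange x y D = (if x \<in> D then insert y (D - {x}) else D)"

lemma card_exchange_le: "finite D \<Longrightarrow> card (exchange x y D) \<le> card D"
  using card_Suc_Diff1[of D x]
  by (auto simp: exchange_def card_insert_if simp del: card_Diff_singleton card_Diff_insert)

text \<open>Reduces a comparison of degrees in two graphs to the sizes of a neighbourhood and of its
  image under an injective map.\<close>

lemma degree_eq_card_Image: "degree G v = card (parcs G `` {v})"
proof -
  have "out_arcs (with_proj G) v = Pair v ` (parcs G `` {v})"
    by (auto simp: out_arcs_def)
  then show ?thesis
    by (simp add: degree_def out_degree_def card_image inj_on_def)
qed

lemma finite_co_even_dominating_set:
  assumes "pair_graph G" "co_even_dominating_set G D"
  shows "finite D"
proof -
  interpret pair_graph G by fact
  show ?thesis
    using assms(2) pair_finite_verts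
    by (auto simp: co_even_dominating_set_def dominating_set_def intro: finite_subset)
qed

lemma co_even_domination_number_le:
  assumes "pair_graph G" "co_even_dominating_set G D"
  shows "co_even_domination_number G \<le> card D"
  unfolding co_even_domination_number_def
  using finite_co_even_dominating_cards[OF assms(1)] assms(2) by (auto intro: Min_le)

lemma co_even_domination_number_attained:
  assumes "pair_graph G"
  obtains D where "co_even_dominating_set G D" "co_even_domination_number G = card D"
proof -
  have "co_even_domination_number G \<in> {card D | D. co_even_dominating_set G D}"
    unfolding co_even_domination_number_def
    using finite_co_even_dominating_cards[OF assms] co_even_dominating_set_pverts[of G]
    by (intro Min_in) auto
  then show ?thesis using that by blast
qed

text \<open>
  The graph \<open>H\<close> contains a copy of \<open>G\<close> under \<open>f\<close> in which the edge \<open>xy\<close> is replaced by an edge from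
  \<open>f y\<close> to an outside vertex \<open>z\<close>; the neighbourhood of \<open>f x\<close> is arbitrary.
\<close>

lemma exchange_co_even_dominates:
  assumes G: "pair_graph G" and xy: "(x, y) \<in> parcs G"
    and inj: "inj_on f (pverts G)" and z: "z \<notin> f ` pverts G"
    and nbrs: "\<And>v. v \<in> pverts G \<Longrightarrow> v \<noteq> x \<Longrightarrow> v \<noteq> y \<Longrightarrow> parcs H `` {f v} = f ` (parcs G `` {v})"
    and nbrs_y: "parcs H `` {f y} = insert z (f ` (parcs G `` {y} - {x}))"
    and D: "co_even_dominating_set G D"
    and S: "f x \<in> S" "f ` exchange x y D \<subseteq> S"
    and v: "v \<in> pverts G" "f v \<notin> S"
  shows "(\<exists>u \<in> S. (f v, u) \<in> parcs H) \<and> even (degree H (f v))"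
proof -
  interpret pair_graph G by fact
  have vx: "v \<noteq> x" using S v by blast
  \<comment> \<open>The exchange removes no vertex but \<open>x\<close>, and \<open>v\<close>
    differs from \<open>x\<close>.\<close>
  have vD: "v \<notin> D" using S(2) v vx by (auto simp: exchange_def split: if_splits)
  have "even (degree G v)" and "\<exists>u \<in> D. (v, u) \<in> parcs G"
    using D v(1) vD by (auto simp: co_even_dominating_set_def dominating_set_def)
  then obtain u where u: "u \<in> D" "(v, u) \<in> parcs G" by blast
  have sub: "parcs G `` {w} \<subseteq> pverts G" for w
    using wellformed by fastforce
  have fin: "finite (parcs G `` {w})" for w
    using sub pair_finite_verts by (rule finite_subset)
  have card_im: "card (f ` A) = card A" if "A \<subseteq> pverts G" for A
    using that inj by (meson card_image inj_on_subset)
  show ?thesis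
  proof (cases "v = y")
    case False
    \<comment> \<open>Either \<open>u\<close> survives the exchange, or \<open>u = x\<close> and its
      image lies in \<open>S\<close> by assumption.\<close>
    have "f u \<in> S" using S u by (cases "u = x") (auto simp: exchange_def split: if_splits)
    moreover have "(f v, f u) \<in> parcs H" using nbrs[OF v(1) vx False] u(2) by blast
    moreover have "degree H (f v) = degree G v"
      by (simp add: degree_eq_card_Image nbrs[OF v(1) vx False] card_im sub)
    ultimately show ?thesis using \<open>even (degree G v)\<close> by auto
  next
    case True
    \<comment> \<open>With \<open>x\<close> in \<open>D\<close>, the exchange would have put
      \<open>f y\<close> into \<open>S\<close>. So the dominator of \<open>y\<close> is not
      \<open>x\<close>, and the edge joining them is not the deleted one.\<close>
    have xD: "x \<notin> D" using S(2) v(2) True by (auto simp: exchange_def split: if_splits)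
    then have "f u \<in> S" and "u \<noteq> x" using S(2) u by (auto simp: exchange_def)
    moreover have "(f v, f u) \<in> parcs H"
      using nbrs_y u(2) \<open>u \<noteq> x\<close> True by blast
    moreover have "degree H (f v) = degree G v"
    proof -
      \<comment> \<open>The new neighbour \<open>z\<close> makes up for the lost neighbour
        \<open>x\<close>: it lies outside the image of \<open>G\<close>, so it coincides with none
        of the remaining neighbours.\<close>
      have "x \<in> parcs G `` {y}" using arcs_symmetric[OF xy] by blast
      have "z \<notin> f ` (parcs G `` {y} - {x})" using z sub by blast
      then have "degree H (f y) = Suc (card (f ` (parcs G `` {y} - {x})))"
        using fin by (simp add: degree_eq_card_Image nbrs_y)
      also have "\<dots> = Suc (card (parcs G `` {y} - {x}))"
        using sub by (subst card_im) auto
      also have "\<dots> = degree G y"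
        using card_Suc_Diff1[OF fin \<open>x \<in> parcs G `` {y}\<close>] by (simp add: degree_eq_card_Image)
      finally show ?thesis using True by simp
    qed
    ultimately show ?thesis using \<open>even (degree G v)\<close> by auto
  qed
qed

lemma parcs_hajos_sum_iff:
  "(a, b) \<in> parcs (hajos_sum G\<^sub>1 x\<^sub>1 y\<^sub>1 G\<^sub>2 x\<^sub>2 y\<^sub>2) \<longleftrightarrow>
    (\<exists>c d. ((c, d) \<in> parcs G\<^sub>1 \<or> (c, d) \<in> parcs G\<^sub>2) \<and>
      (c, d) \<notin> {(x\<^sub>1, y\<^sub>1), (y\<^sub>1, x\<^sub>1), (x\<^sub>2, y\<^sub>2), (y\<^sub>2, x\<^sub>2)} \<and>
      a = identify x\<^sub>1 x\<^sub>2 c \<and> b = identify x\<^sub>1 x\<^sub>2 d)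
    \<or> (a, b) = (y\<^sub>1, y\<^sub>2) \<or> (a, b) = (y\<^sub>2, y\<^sub>1)"
proof -
  have "(a, b) \<in> map_prod f f ` A \<longleftrightarrow> (\<exists>c d. (c, d) \<in> A \<and> a = f c \<and> b = f d)" for f A
    by (simp add: image_iff Bex_def)
  then show ?thesis by (simp only: hajos_sum_def pair_pre_digraph.simps) auto
qed

theorem theorem4p1:
  fixes G\<^sub>1 G\<^sub>2 :: "'a pair_pre_digraph"
  assumes "pair_graph G\<^sub>1" and "pair_graph G\<^sub>2"
    and "Digraph_Component.connected (with_proj G\<^sub>1)"
    and "Digraph_Component.connected (with_proj G\<^sub>2)"
    and "pverts G\<^sub>1 \<inter> pverts G\<^sub>2 = {}"
    and "(x\<^sub>1, y\<^sub>1) \<in> parcs G\<^sub>1" and "(x\<^sub>2, y\<^sub>2) \<in> parcs G\<^sub>2"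
    and "G\<^sub>3 = hajos_sum G\<^sub>1 x\<^sub>1 y\<^sub>1 G\<^sub>2 x\<^sub>2 y\<^sub>2"
  shows "co_even_domination_number G\<^sub>3
           \<le> co_even_domination_number G\<^sub>1 + co_even_domination_number G\<^sub>2 + 1"
proof -
  interpret G1: pair_graph G\<^sub>1 by fact
  interpret G2: pair_graph G\<^sub>2 by fact
  let ?f = "identify x\<^sub>1 x\<^sub>2"
  note disj = assms(5) and e1 = assms(6) and e2 = assms(7) and G3 = assms(8)
  have w1: "a \<in> pverts G\<^sub>1 \<and> b \<in> pverts G\<^sub>1 \<and> a \<noteq> b" if "(a, b) \<in> parcs G\<^sub>1" for a b
    using G1.wellformed[OF that] G1.no_loops[OF that] by auto
  have w2: "a \<in> pverts G\<^sub>2 \<and> b \<in> pverts G\<^sub>2 \<and> a \<noteq> b" if "(a, b) \<in> parcs G\<^sub>2" for a b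
    using G2.wellformed[OF that] G2.no_loops[OF that] by auto
  note V1 = w1[OF e1] and V2 = w2[OF e2]
  \<comment> \<open>The merged vertex keeps the name \<open>x\<^sub>1\<close>, so the quotient map
    fixes the first graph pointwise and renames only \<open>x\<^sub>2\<close> in the second.\<close>
  have f1: "?f v = v" if "v \<in> pverts G\<^sub>1" for v
    using that V2 disj by (auto simp: identify_def)
  have f2: "?f v = v" if "v \<noteq> x\<^sub>2" for v
    using that by (auto simp: identify_def)
  have fx2: "?f x\<^sub>2 = x\<^sub>1" by (simp add: identify_def)
  have inj1: "inj_on ?f (pverts G\<^sub>1)" and inj2: "inj_on ?f (pverts G\<^sub>2)"
    using V1 V2 disj by (auto simp: inj_on_def identify_def)
  have fV1: "?f ` pverts G\<^sub>1 = pverts G\<^sub>1" using f1 by force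
  have fV2: "?f ` pverts G\<^sub>2 \<subseteq> insert x\<^sub>1 (pverts G\<^sub>2)" by (auto simp: identify_def)
  have z1: "y\<^sub>2 \<notin> ?f ` pverts G\<^sub>1" using fV1 V2 disj by auto
  have z2: "y\<^sub>1 \<notin> ?f ` pverts G\<^sub>2" using subsetD[OF fV2, of "y\<^sub>1"] V1 disj by auto
  have no1: "(v, d) \<notin> parcs G\<^sub>1" if "v \<in> pverts G\<^sub>2" for v d
    using that w1[of v d] disj by auto
  have no2: "(v, d) \<notin> parcs G\<^sub>2" if "v \<in> pverts G\<^sub>1" for v d
    using that w2[of v d] disj by auto
  \<comment> \<open>The only fibre with two elements is that of the merged vertex. Any other vertex
    is its own sole preimage, so the arcs it inherits in the sum are its own old arcs.\<close>
  have own1: "v = ?f c \<longleftrightarrow> c = v" if "v \<in> pverts G\<^sub>1" "v \<noteq> x\<^sub>1" for c v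
    using that V2 disj by (auto simp: identify_def)
  have own2: "v = ?f c \<longleftrightarrow> c = v" if "v \<in> pverts G\<^sub>2" "v \<noteq> x\<^sub>2" for c v
    using that V1 disj by (auto simp: identify_def)
  \<comment> \<open>Of the four deleted arcs, only \<open>(y\<^sub>1, x\<^sub>1)\<close> can leave a
    vertex of the first graph other than \<open>x\<^sub>1\<close>.\<close>
  have arc1: "(?f v, b) \<in> parcs G\<^sub>3 \<longleftrightarrow>
      (\<exists>d. (v, d) \<in> parcs G\<^sub>1 \<and> (v, d) \<noteq> (y\<^sub>1, x\<^sub>1) \<and> b = ?f d) \<or> v = y\<^sub>1 \<and> b = y\<^sub>2"
    if v: "v \<in> pverts G\<^sub>1" "v \<noteq> x\<^sub>1" for v b
  proof -
    have "v \<noteq> x\<^sub>2" "v \<noteq> y\<^sub>2" "(v, d) \<notin> parcs G\<^sub>2" for d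
      using v no2[OF v(1)] V2 disj by auto
    then show ?thesis
      unfolding G3 parcs_hajos_sum_iff f1[OF v(1)] by (simp add: own1[OF v] v(2))
  qed
  have arc2: "(?f v, b) \<in> parcs G\<^sub>3 \<longleftrightarrow>
      (\<exists>d. (v, d) \<in> parcs G\<^sub>2 \<and> (v, d) \<noteq> (y\<^sub>2, x\<^sub>2) \<and> b = ?f d) \<or> v = y\<^sub>2 \<and> b = y\<^sub>1"
    if v: "v \<in> pverts G\<^sub>2" "v \<noteq> x\<^sub>2" for v b
  proof -
    have "v \<noteq> x\<^sub>1" "v \<noteq> y\<^sub>1" "(v, d) \<notin> parcs G\<^sub>1" for d
      using v no1[OF v(1)] V1 disj by auto
    then show ?thesis
      unfolding G3 parcs_hajos_sum_iff f2[OF v(2)] by (simp add: own2[OF v] v(2))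
  qed
  have N1: "parcs G\<^sub>3 `` {?f v} = ?f ` (parcs G\<^sub>1 `` {v})"
    if "v \<in> pverts G\<^sub>1" "v \<noteq> x\<^sub>1" "v \<noteq> y\<^sub>1" for v
    using that(3) by (auto simp: arc1[OF that(1,2)])
  have N1y: "parcs G\<^sub>3 `` {?f y\<^sub>1} = insert y\<^sub>2 (?f ` (parcs G\<^sub>1 `` {y\<^sub>1} - {x\<^sub>1}))"
    using V1 by (auto simp: arc1)
  have N2: "parcs G\<^sub>3 `` {?f v} = ?f ` (parcs G\<^sub>2 `` {v})"
    if "v \<in> pverts G\<^sub>2" "v \<noteq> x\<^sub>2" "v \<noteq> y\<^sub>2" for v
    using that(3) by (auto simp: arc2[OF that(1,2)])
  have N2y: "parcs G\<^sub>3 `` {?f y\<^sub>2} = insert y\<^sub>1 (?f ` (parcs G\<^sub>2 `` {y\<^sub>2} - {x\<^sub>2}))"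
    using V2 by (auto simp: arc2)
  obtain D\<^sub>1 where D1: "co_even_dominating_set G\<^sub>1 D\<^sub>1" "co_even_domination_number G\<^sub>1 = card D\<^sub>1"
    using assms(1) by (rule co_even_domination_number_attained)
  obtain D\<^sub>2 where D2: "co_even_dominating_set G\<^sub>2 D\<^sub>2" "co_even_domination_number G\<^sub>2 = card D\<^sub>2"
    using assms(2) by (rule co_even_domination_number_attained)
  note fin1 = finite_co_even_dominating_set[OF assms(1) D1(1)]
    and fin2 = finite_co_even_dominating_set[OF assms(2) D2(1)]
  let ?E = "exchange x\<^sub>1 y\<^sub>1 D\<^sub>1 \<union> exchange x\<^sub>2 y\<^sub>2 D\<^sub>2"
  \<comment> \<open>The merged vertex is inserted unconditionally, so neither its domination nor the
    parity of its degree has to be checked. This accounts for the \<open>+ 1\<close> in the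
    bound.\<close>
  define S where "S = insert x\<^sub>1 (?f ` ?E)"
  have V3: "pverts G\<^sub>3 = ?f ` (pverts G\<^sub>1 \<union> pverts G\<^sub>2)" by (simp add: G3 hajos_sum_def)
  have E: "?E \<subseteq> pverts G\<^sub>1 \<union> pverts G\<^sub>2"
    using D1(1) D2(1) V1 V2
    by (auto simp: co_even_dominating_set_def dominating_set_def exchange_def)
  have x1S: "?f x\<^sub>1 \<in> S" "?f x\<^sub>2 \<in> S" using f1 V1 fx2 by (auto simp: S_def)
  have "x\<^sub>1 \<in> pverts G\<^sub>3" unfolding V3 using V2 fx2 by (metis UnI2 image_eqI)
  then have "S \<subseteq> pverts G\<^sub>3" using E unfolding S_def V3 by blast
  moreover have "(\<exists>u \<in> S. (w, u) \<in> parcs G\<^sub>3) \<and> even (degree G\<^sub>3 w)"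
    if "w \<in> pverts G\<^sub>3 - S" for w
  proof -
    have "w \<in> ?f ` (pverts G\<^sub>1 \<union> pverts G\<^sub>2)" "w \<notin> S" using that V3 by simp_all
    then obtain v where v: "w = ?f v" "?f v \<notin> S" "v \<in> pverts G\<^sub>1 \<or> v \<in> pverts G\<^sub>2"
      by (elim imageE) simp
    have sub: "?f ` exchange x\<^sub>1 y\<^sub>1 D\<^sub>1 \<subseteq> S" "?f ` exchange x\<^sub>2 y\<^sub>2 D\<^sub>2 \<subseteq> S"
      by (auto simp: S_def)
    \<comment> \<open>Both cases embed a summand by the same map; the outside vertex
      \<open>z\<close> is \<open>y\<^sub>2\<close> for the first graph and \<open>y\<^sub>1\<close>
      for the second.\<close>
    from v(3) show ?thesis
      unfolding v(1)
    proof
      assume "v \<in> pverts G\<^sub>1"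
      then show "(\<exists>u \<in> S. (?f v, u) \<in> parcs G\<^sub>3) \<and> even (degree G\<^sub>3 (?f v))"
        by (intro exchange_co_even_dominates
            [OF assms(1) e1 inj1 z1 _ N1y D1(1) x1S(1) sub(1) _ v(2)] N1)
    next
      assume "v \<in> pverts G\<^sub>2"
      then show "(\<exists>u \<in> S. (?f v, u) \<in> parcs G\<^sub>3) \<and> even (degree G\<^sub>3 (?f v))"
        by (intro exchange_co_even_dominates
            [OF assms(2) e2 inj2 z2 _ N2y D2(1) x1S(2) sub(2) _ v(2)] N2)
    qed
  qed
  ultimately have "co_even_dominating_set G\<^sub>3 S"
    by (simp add: co_even_dominating_set_def dominating_set_def)
  moreover have "pair_graph G\<^sub>3"
    unfolding G3 using assms(1,2) disj e1 e2 by (rule pair_graph_hajos_sum)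
  ultimately have "co_even_domination_number G\<^sub>3 \<le> card S"
    by (simp add: co_even_domination_number_le)
  also have "\<dots> \<le> card ?E + 1"
  proof -
    have "finite ?E" using fin1 fin2 by (simp add: exchange_def)
    then have "card (?f ` ?E) \<le> card ?E" by (rule card_image_le)
    moreover have "card S \<le> Suc (card (?f ` ?E))" unfolding S_def by (rule card_insert_le_m1) auto
    ultimately show ?thesis by simp
  qed
  also have "\<dots> \<le> card D\<^sub>1 + card D\<^sub>2 + 1"
    using card_Un_le[of "exchange x\<^sub>1 y\<^sub>1 D\<^sub>1" "exchange x\<^sub>2 y\<^sub>2 D\<^sub>2"]
      card_exchange_le[OF fin1, of x\<^sub>1 y\<^sub>1] card_exchange_le[OF fin2, of x\<^sub>2 y\<^sub>2] by linarith
  finally show ?thesis using D1(2) D2(2) by simp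
qed

end
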